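(* Let $(V,v)$ be a valued $K$-vector space with value group $\Gamma$, let $A\subseteq V^m$ and $B\subseteq V^n$ be finite, let $f,g:V^{m+n}\to V$ be affine $K$-linear maps, let $\square\in\{>,\ge\}$, and put $$E:=\{(x,y)\in A\times B: v(f(x,y))\ \square\ v(g(x,y))\}.$$ For $\gamma\in\Gamma\cup\{\infty\}$ let $E_{=\gamma}:=\{(x,y)\in E:v(g(x,y))=\gamma\}$ and let $G_{=\gamma}:=(A,B;E_{=\gamma})$ be the corresponding bipartite graph. Let $\mathcal C$ be the collection of all edge-containing connected components of the graphs $G_{=\gamma}$, as $\gamma$ varies over $\Gamma\cup\{\infty\}$. For $C\in\mathcal C$ write $A(C):=C\cap A$ and $B(C):=C\cap B$ for the sets of vertices of $C$ on the two sides. Then both set systems $$\mathcal A:=\{A(C):C\in\mathcal C\},\qquad \mathcal B:=\{B(C):C\in\mathcal C\}$$ are laminar.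
   Context: A valued $K$-vector space over a valued field $(K,v_K)$ with value group $\Gamma_K$ is a $K$-vector space $V$ with an ordered abelian group $\Gamma\supseteq\Gamma_K$ and a map $v:V\to\Gamma\cup\{\infty\}$ such that $v(x)=\infty\iff x=0$, $v(x+y)\ge\min\{v(x),v(y)\}$, and $v(\lambda x)=v_K(\lambda)+v(x)$ for $\lambda\in K$. An affine $K$-linear map is a linear map with scalar coefficients in $K$ plus a constant vector of $V$. A family of sets is laminar if any two of its members are disjoint or comparable by inclusion. In a bipartite graph the two sides $A$ and $B$ are treated as disjoint vertex classes. *)

theory Defs
  imports Complex_Main
begin

text \<open>The set \<open>\<Gamma> \<union> {\<infinity>}\<close> for an ordered abelian group \<open>\<Gamma>\<close>: \<open>Infty\<close> is the greatest element
  and absorbs addition.\<close>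

datatype 'g with_infty = Val 'g | Infty

instantiation with_infty :: (linorder) linorder
begin

fun less_eq_with_infty :: "'a with_infty \<Rightarrow> 'a with_infty \<Rightarrow> bool" where
  "less_eq_with_infty _ Infty = True"
| "less_eq_with_infty Infty (Val _) = False"
| "less_eq_with_infty (Val a) (Val b) = (a \<le> b)"

definition less_with_infty :: "'a with_infty \<Rightarrow> 'a with_infty \<Rightarrow> bool" where
  "less_with_infty x y = (x \<le> y \<and> \<not> y \<le> x)"

instance
proof
  fix x y z :: "'a with_infty"
  show "(x < y) = (x \<le> y \<and> \<not> y \<le> x)"
    by (fact less_with_infty_def)
  show "x \<le> x"
    by (cases x) auto
  show "x \<le> y \<Longrightarrow> y \<le> z \<Longrightarrow> x \<le> z"
    by (cases x; cases y; cases z) auto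
  show "x \<le> y \<Longrightarrow> y \<le> x \<Longrightarrow> x = y"
    by (cases x; cases y) auto
  show "x \<le> y \<or> y \<le> x"
    by (cases x; cases y) auto
qed

end

instantiation with_infty :: (plus) plus
begin

fun plus_with_infty :: "'a with_infty \<Rightarrow> 'a with_infty \<Rightarrow> 'a with_infty" where
  "plus_with_infty (Val a) (Val b) = Val (a + b)"
| "plus_with_infty Infty _ = Infty"
| "plus_with_infty _ Infty = Infty"

instance ..

end

text \<open>The valuation of the field takes its values directly in the larger group \<open>\<Gamma>\<close> (the type
  \<open>'g\<close>), so that the inclusion of \<open>\<Gamma>\<^sub>K\<close> in \<open>\<Gamma>\<close> is a subset relation: \<open>\<Gamma>\<^sub>K\<close> is the set of values
  of the nonzero scalars, and the axioms make it a subgroup of \<open>\<Gamma>\<close>. It may be a proper subgroup.\<close>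

locale valued_field =
  fixes vK :: "'k::field \<Rightarrow> 'g::linordered_ab_group_add with_infty"
  assumes vK_eq_Infty_iff: "vK a = Infty \<longleftrightarrow> a = 0"
    and vK_mult: "vK (a * b) = vK a + vK b"
    and vK_add: "vK (a + b) \<ge> min (vK a) (vK b)"

locale valued_vector_space = valued_field vK + vector_space scale
  for vK :: "'k::field \<Rightarrow> 'g::linordered_ab_group_add with_infty"
    and scale :: "'k \<Rightarrow> 'v::ab_group_add \<Rightarrow> 'v" +
  fixes v :: "'v \<Rightarrow> 'g with_infty"
  assumes v_eq_Infty_iff: "v x = Infty \<longleftrightarrow> x = 0"
    and v_add: "v (x + y) \<ge> min (v x) (v y)"
    and v_scale: "v (scale c x) = vK c + v x"

text \<open>Elements of \<open>V\<^sup>k\<close> are lists of length \<open>k\<close>; the identification of \<open>V\<^sup>m \<times> V\<^sup>n\<close> with \<open>V\<^sup>m\<^sup>+\<^sup>n\<close>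
  is list concatenation.\<close>

definition vectors :: "nat \<Rightarrow> 'v list set" where
  "vectors k = {z. length z = k}"

definition affine_map_on ::
  "('k \<Rightarrow> 'v::ab_group_add \<Rightarrow> 'v) \<Rightarrow> nat \<Rightarrow> ('v list \<Rightarrow> 'v) \<Rightarrow> bool" where
  "affine_map_on scale k f \<longleftrightarrow>
    (\<exists>c d. \<forall>z \<in> vectors k. f z = (\<Sum>i<k. scale (c i) (z ! i)) + d)"

text \<open>The bipartite graph \<open>(A, B; E)\<close>, where \<open>E \<subseteq> A \<times> B\<close>, has vertex set \<open>A <+> B\<close>, so that the two
  sides are disjoint even if \<open>A\<close> and \<open>B\<close> overlap. Its components are given by their vertex sets.\<close>

definition bip_adj :: "('a \<times> 'b) set \<Rightarrow> ('a + 'b) rel" where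
  "bip_adj E = (\<Union>(a, b) \<in> E. {(Inl a, Inr b), (Inr b, Inl a)})"

definition bip_components :: "'a set \<Rightarrow> 'b set \<Rightarrow> ('a \<times> 'b) set \<Rightarrow> ('a + 'b) set set" where
  "bip_components A B E = (A <+> B) // (bip_adj E)\<^sup>*"

definition edge_components :: "'a set \<Rightarrow> 'b set \<Rightarrow> ('a \<times> 'b) set \<Rightarrow> ('a + 'b) set set" where
  "edge_components A B E =
    {C \<in> bip_components A B E. \<exists>(a, b) \<in> E. Inl a \<in> C \<and> Inr b \<in> C}"

definition left_side :: "('a + 'b) set \<Rightarrow> 'a set" where
  "left_side C = Inl -` C"

definition right_side :: "('a + 'b) set \<Rightarrow> 'b set" where
  "right_side C = Inr -` C"

definition laminar :: "'a set set \<Rightarrow> bool" where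
  "laminar F \<longleftrightarrow> (\<forall>X \<in> F. \<forall>Y \<in> F. X \<inter> Y = {} \<or> X \<subseteq> Y \<or> Y \<subseteq> X)"

end

theory Submission
  imports Defs
begin

text \<open>An affine map on \<open>V\<^sup>m\<^sup>+\<^sup>n\<close> separates its two blocks of variables, so \<open>f (x @ y) = p x - q y\<close> and
  \<open>g (x @ y) = r x - s y\<close>. Each vertex \<open>u\<close> of the bipartite graph thereby gets two points \<open>P u\<close> and
  \<open>Q u\<close> of \<open>V\<close>, whichever side it lies on, and adjacency at level \<open>\<gamma>\<close> says that the points \<open>P\<close> of
  two vertices on opposite sides are close (\<open>\<ge> \<gamma>\<close> or \<open>> \<gamma>\<close>) while their points \<open>Q\<close> are at
  valuation exactly \<open>\<gamma>\<close>.

  By the ultrametric inequality, two vertices joined by a path at level \<open>\<gamma>\<^sub>2\<close> have \<open>P\<close> and \<open>Q\<close> in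
  common closed balls of level \<open>\<gamma>\<^sub>2\<close>. If \<open>\<gamma>\<^sub>1 < \<gamma>\<^sub>2\<close>, moving a vertex inside such balls is
  invisible at level \<open>\<gamma>\<^sub>1\<close>: two such vertices on one side have the same neighbours there. Hence, if
  components \<open>C\<^sub>1\<close> and \<open>C\<^sub>2\<close> at levels \<open>\<gamma>\<^sub>1 < \<gamma>\<^sub>2\<close> share a vertex \<open>u\<close>, every vertex of \<open>C\<^sub>2\<close> on the
  side of \<open>u\<close> is adjacent at level \<open>\<gamma>\<^sub>1\<close> to a neighbour of \<open>u\<close>, and so lies in \<open>C\<^sub>1\<close>. Two components
  at one level are equal or disjoint, and laminarity follows. The argument treats both sides at
  once, because it refers only to vertices on the same side.\<close>

section \<open>Components of a bipartite graph\<close>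

lemma bip_adj_Inl_Inr [simp]: "(Inl a, Inr b) \<in> bip_adj E \<longleftrightarrow> (a, b) \<in> E"
  and bip_adj_Inr_Inl [simp]: "(Inr b, Inl a) \<in> bip_adj E \<longleftrightarrow> (a, b) \<in> E"
  and bip_adj_Inl_Inl [simp]: "(Inl a, Inl a') \<notin> bip_adj E"
  and bip_adj_Inr_Inr [simp]: "(Inr b, Inr b') \<notin> bip_adj E"
  by (auto simp: bip_adj_def)

lemma sym_bip_adj: "sym (bip_adj E)"
  by (auto simp: sym_def bip_adj_def)

lemma bip_component_eq_reachable:
  assumes "C \<in> bip_components A B E" and "u \<in> C"
  shows "C = (bip_adj E)\<^sup>* `` {u}"
proof -
  obtain z where C: "C = (bip_adj E)\<^sup>* `` {z}"
    using assms(1) by (auto simp: bip_components_def quotient_def)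
  with assms(2) have "(z, u) \<in> (bip_adj E)\<^sup>*" by simp
  moreover from this have "(u, z) \<in> (bip_adj E)\<^sup>*"
    using sym_rtrancl[OF sym_bip_adj] by (blast dest: symD)
  ultimately show ?thesis
    using C by (auto intro: rtrancl_trans)
qed

lemma edge_components_subset: "edge_components A B E \<subseteq> bip_components A B E"
  by (auto simp: edge_components_def)

lemma edge_component_neighbour:
  assumes "C \<in> edge_components A B E" and "u \<in> C"
  obtains w where "(u, w) \<in> bip_adj E"
proof -
  obtain a b where ab: "(a, b) \<in> E" "Inl a \<in> C"
    using assms(1) by (auto simp: edge_components_def)
  have "C \<in> bip_components A B E"
    using assms(1) edge_components_subset by blast
  from bip_component_eq_reachable[OF this assms(2)] ab(2)
  have "(u, Inl a) \<in> (bip_adj E)\<^sup>*" by auto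
  then show thesis
  proof (cases rule: converse_rtranclE)
    case base
    then show thesis using ab(1) that[of "Inr b"] by simp
  next
    case (step w)
    then show thesis using that by blast
  qed
qed

section \<open>Ultrametric estimates\<close>

context valued_vector_space
begin

text \<open>The value group is torsion-free, so \<open>(-1) * (-1) = 1\<close> forces \<open>-1\<close> to have value zero.\<close>

lemma vK_minus_one: "vK (- 1) = Val 0"
proof -
  obtain c where c: "vK 1 = Val c"
    using vK_eq_Infty_iff[of 1] by (cases "vK 1") auto
  obtain d where d: "vK (- 1) = Val d"
    using vK_eq_Infty_iff[of "- 1"] by (cases "vK (- 1)") auto
  have "c + c = c" using vK_mult[of 1 1] c by simp
  moreover have "d + d = c" using vK_mult[of "- 1" "- 1"] c d by simp
  ultimately show ?thesis using d by simp
qed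

lemma v_minus: "v (- x) = v x"
  using v_scale[of "- 1" x] by (cases "v x") (simp_all add: vK_minus_one)

lemma v_diff_commute: "v (x - y) = v (y - x)"
  using v_minus[of "x - y"] by simp

lemma v_diff_triangle: "min (v (x - y)) (v (y - z)) \<le> v (x - z)"
  using v_add[of "x - y" "y - z"] by simp

lemma v_diff_eq_of_near:
  assumes near: "\<gamma> < v (x' - x)" and eq: "v (x - y) = \<gamma>"
  shows "v (x' - y) = \<gamma>"
proof (rule antisym)
  show "\<gamma> \<le> v (x' - y)"
    using v_diff_triangle[of x' x y] near eq by simp
  have "min (v (x - x')) (v (x' - y)) \<le> \<gamma>"
    using v_diff_triangle[of x x' y] eq by simp
  then show "v (x' - y) \<le> \<gamma>"
    using near by (auto simp: v_diff_commute[of x x'] min_le_iff_disj)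
qed

lemma v_diff_rel_of_near:
  assumes R: "R = (>) \<or> R = (\<ge>)"
    and near: "\<gamma> < v (x' - x)" and rel: "R (v (x - y)) \<gamma>"
  shows "R (v (x' - y)) \<gamma>"
  using R
proof
  assume "R = (>)"
  with near rel have "\<gamma> < min (v (x' - x)) (v (x - y))" by simp
  from less_le_trans[OF this v_diff_triangle] \<open>R = (>)\<close> show ?thesis by simp
next
  assume "R = (\<ge>)"
  with near rel have "\<gamma> \<le> min (v (x' - x)) (v (x - y))" by simp
  from order_trans[OF this v_diff_triangle] \<open>R = (\<ge>)\<close> show ?thesis by simp
qed

section \<open>Nesting of components at different levels\<close>

definition level_edges ::
  "('g with_infty \<Rightarrow> 'g with_infty \<Rightarrow> bool) \<Rightarrow> 'a set \<Rightarrow> 'b set \<Rightarrow> ('a + 'b \<Rightarrow> 'v) \<Rightarrow> ('a + 'b \<Rightarrow> 'v)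
    \<Rightarrow> 'g with_infty \<Rightarrow> ('a \<times> 'b) set" where
  "level_edges R A B P Q \<gamma> =
    {(a, b) \<in> A \<times> B. R (v (P (Inl a) - P (Inr b))) \<gamma> \<and> v (Q (Inl a) - Q (Inr b)) = \<gamma>}"

text \<open>Because \<open>v\<close> is even, adjacency can be stated without saying which of the two vertices is on
  the left.\<close>

lemma bip_adj_level_edges_iff:
  "(u, w) \<in> bip_adj (level_edges R A B P Q \<gamma>) \<longleftrightarrow>
    u \<in> A <+> B \<and> w \<in> A <+> B \<and> isl u \<noteq> isl w \<and>
    R (v (P u - P w)) \<gamma> \<and> v (Q u - Q w) = \<gamma>"
proof (cases u; cases w)
  fix b a
  assume "u = Inr b" and "w = Inl a"
  then show ?thesis
    using v_diff_commute[of "P u" "P w"] v_diff_commute[of "Q u" "Q w"]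
    by (auto simp: level_edges_def)
qed (auto simp: level_edges_def)

lemma level_path_near:
  assumes R: "R = (>) \<or> R = (\<ge>)"
    and path: "(u, w) \<in> (bip_adj (level_edges R A B P Q \<gamma>))\<^sup>*"
  shows "\<gamma> \<le> v (P w - P u) \<and> \<gamma> \<le> v (Q w - Q u)"
  using path
proof (induction rule: rtrancl_induct)
  case base
  have "v 0 = Infty" by (simp add: v_eq_Infty_iff)
  then show ?case by simp
next
  case (step y z)
  from step.hyps(2) have "R (v (P y - P z)) \<gamma>" "v (Q y - Q z) = \<gamma>"
    by (auto simp: bip_adj_level_edges_iff)
  with R have "\<gamma> \<le> v (P z - P y)" "\<gamma> \<le> v (Q z - Q y)"
    by (auto simp: v_diff_commute[of "P z"] v_diff_commute[of "Q z"])
  with step.IH show ?case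
    using v_diff_triangle[of "P z" "P y" "P u"] v_diff_triangle[of "Q z" "Q y" "Q u"]
    by (meson min.boundedI order_trans)
qed

text \<open>The vertex \<open>u'\<close> has \<open>P u'\<close> and \<open>Q u'\<close> in the closed balls of level \<open>\<gamma>\<^sub>2\<close> around \<open>P u\<close> and \<open>Q u\<close>,
  so at the smaller level \<open>\<gamma>\<^sub>1\<close> it inherits the neighbours of \<open>u\<close>. Some neighbour \<open>w\<close> of \<open>u\<close> exists because \<open>C\<^sub>1\<close> contains an
  edge, and it connects \<open>u\<close> to \<open>u'\<close> inside \<open>C\<^sub>1\<close>.\<close>

lemma lower_component_absorbs_same_side:
  assumes R: "R = (>) \<or> R = (\<ge>)" and less: "\<gamma>\<^sub>1 < \<gamma>\<^sub>2"
    and C1: "C\<^sub>1 \<in> edge_components A B (level_edges R A B P Q \<gamma>\<^sub>1)"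
    and C2: "C\<^sub>2 \<in> edge_components A B (level_edges R A B P Q \<gamma>\<^sub>2)"
    and u: "u \<in> C\<^sub>1" "u \<in> C\<^sub>2" and u': "u' \<in> C\<^sub>2" and side: "isl u' = isl u"
  shows "u' \<in> C\<^sub>1"
proof -
  let ?E = "level_edges R A B P Q"
  have C1_reach: "C\<^sub>1 = (bip_adj (?E \<gamma>\<^sub>1))\<^sup>* `` {u}"
    using C1 u(1) edge_components_subset by (blast intro!: bip_component_eq_reachable)
  have C2_reach: "C\<^sub>2 = (bip_adj (?E \<gamma>\<^sub>2))\<^sup>* `` {x}" if "x \<in> C\<^sub>2" for x
    using C2 that edge_components_subset by (blast intro!: bip_component_eq_reachable)
  have path: "(u, u') \<in> (bip_adj (?E \<gamma>\<^sub>2))\<^sup>*"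
    using C2_reach[OF u(2)] u' by blast
  have near: "\<gamma>\<^sub>1 < v (P u' - P u)" "\<gamma>\<^sub>1 < v (Q u' - Q u)"
    using level_path_near[OF R path] less by auto
  obtain w where w: "(u, w) \<in> bip_adj (?E \<gamma>\<^sub>1)"
    using edge_component_neighbour[OF C1 u(1)] .
  have "u' \<in> A <+> B"
    using edge_component_neighbour[OF C2 u'] by (auto simp: bip_adj_level_edges_iff)
  with w side have "(u', w) \<in> bip_adj (?E \<gamma>\<^sub>1)"
    using v_diff_rel_of_near[OF R near(1)] v_diff_eq_of_near[OF near(2)]
    by (simp add: bip_adj_level_edges_iff)
  then have "(w, u') \<in> bip_adj (?E \<gamma>\<^sub>1)"
    using sym_bip_adj by (blast dest: symD)
  with w show ?thesis
    using C1_reach by auto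
qed

text \<open>The map \<open>side\<close> stands for either of the two injections \<open>Inl\<close> and \<open>Inr\<close>, so that \<open>side -` C\<close> is
  the corresponding side of \<open>C\<close>.\<close>

lemma laminar_component_sides:
  fixes side :: "'c \<Rightarrow> 'a + 'b"
  assumes R: "R = (>) \<or> R = (\<ge>)" and side: "\<And>x y. isl (side x) = isl (side y)"
  shows "laminar ((\<lambda>C. side -` C) ` (\<Union>\<gamma>. edge_components A B (level_edges R A B P Q \<gamma>)))"
  unfolding laminar_def
proof (intro ballI)
  let ?comps = "\<lambda>\<gamma>. edge_components A B (level_edges R A B P Q \<gamma>)"
  fix X Y
  assume "X \<in> (\<lambda>C. side -` C) ` (\<Union>\<gamma>. ?comps \<gamma>)" and "Y \<in> (\<lambda>C. side -` C) ` (\<Union>\<gamma>. ?comps \<gamma>)"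
  then obtain C D \<gamma> \<delta> where C: "C \<in> ?comps \<gamma>" "X = side -` C" and D: "D \<in> ?comps \<delta>" "Y = side -` D"
    by auto
  show "X \<inter> Y = {} \<or> X \<subseteq> Y \<or> Y \<subseteq> X"
  proof (cases "X \<inter> Y = {}")
    case False
    then obtain x where x: "side x \<in> C" "side x \<in> D" using C D by auto
    consider "\<gamma> < \<delta>" | "\<gamma> = \<delta>" | "\<delta> < \<gamma>" by force
    then show ?thesis
    proof cases
      case 1
      have "Y \<subseteq> X"
        using lower_component_absorbs_same_side[OF R 1 C(1) D(1) x _ side] C D by auto
      then show ?thesis by blast
    next
      case 2
      have "C = D"
        using bip_component_eq_reachable[OF _ x(1)] bip_component_eq_reachable[OF _ x(2)]
          C(1) D(1) 2 edge_components_subset by blast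
      then show ?thesis using C D by simp
    next
      case 3
      have "X \<subseteq> Y"
        using lower_component_absorbs_same_side[OF R 3 D(1) C(1) x(2,1) _ side] C D by auto
      then show ?thesis by blast
    qed
  qed blast
qed

end

section \<open>Separation of variables and the theorem\<close>

lemma sum_lessThan_add:
  fixes h :: "nat \<Rightarrow> 'a::comm_monoid_add"
  shows "(\<Sum>i<m + n. h i) = (\<Sum>i<m. h i) + (\<Sum>i<n. h (m + i))"
  by (induction n) (simp_all add: ac_simps)

text \<open>The minus sign is chosen so that a large valuation of \<open>f (x @ y)\<close> says that \<open>p x\<close> and \<open>q y\<close> are
  close;
  the constant term may go to either block.\<close>

lemma affine_map_on_append:
  assumes "affine_map_on scale (m + n) f"
  obtains p q where "\<And>x y. x \<in> vectors m \<Longrightarrow> y \<in> vectors n \<Longrightarrow> f (x @ y) = p x - q y"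
proof -
  obtain c d where f: "\<And>z. z \<in> vectors (m + n) \<Longrightarrow> f z = (\<Sum>i<m + n. scale (c i) (z ! i)) + d"
    using assms by (auto simp: affine_map_on_def)
  define p where "p x = (\<Sum>i<m. scale (c i) (x ! i)) + d" for x
  define q where "q y = - (\<Sum>i<n. scale (c (m + i)) (y ! i))" for y
  have "f (x @ y) = p x - q y" if "x \<in> vectors m" "y \<in> vectors n" for x y
    using that f[of "x @ y"]
    by (simp add: vectors_def sum_lessThan_add nth_append p_def q_def algebra_simps)
  then show thesis using that by blast
qed

theorem proposition3p3:
  fixes vK :: "'k::field \<Rightarrow> 'g::linordered_ab_group_add with_infty"
    and scale :: "'k \<Rightarrow> 'v::ab_group_add \<Rightarrow> 'v"
    and v :: "'v \<Rightarrow> 'g with_infty"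
    and m n :: nat
    and A B :: "'v list set"
    and f g :: "'v list \<Rightarrow> 'v"
    and R :: "'g with_infty \<Rightarrow> 'g with_infty \<Rightarrow> bool"
    and E :: "('v list \<times> 'v list) set"
    and E_eq :: "'g with_infty \<Rightarrow> ('v list \<times> 'v list) set"
    and \<C> :: "('v list + 'v list) set set"
  assumes "valued_vector_space vK scale v"
    and "finite A" and "A \<subseteq> vectors m"
    and "finite B" and "B \<subseteq> vectors n"
    and "affine_map_on scale (m + n) f"
    and "affine_map_on scale (m + n) g"
    and "R = (>) \<or> R = (\<ge>)"
    and "E = {(x, y) \<in> A \<times> B. R (v (f (x @ y))) (v (g (x @ y)))}"
    and "\<And>\<gamma>. E_eq \<gamma> = {(x, y) \<in> E. v (g (x @ y)) = \<gamma>}"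
    and "\<C> = (\<Union>\<gamma>. edge_components A B (E_eq \<gamma>))"
  shows "laminar (left_side ` \<C>) \<and> laminar (right_side ` \<C>)"
proof -
  interpret valued_vector_space vK scale v by fact
  obtain p q where f: "\<And>x y. x \<in> vectors m \<Longrightarrow> y \<in> vectors n \<Longrightarrow> f (x @ y) = p x - q y"
    using affine_map_on_append[OF assms(6)] by blast
  obtain r s where g: "\<And>x y. x \<in> vectors m \<Longrightarrow> y \<in> vectors n \<Longrightarrow> g (x @ y) = r x - s y"
    using affine_map_on_append[OF assms(7)] by blast
  have "E_eq \<gamma> = level_edges R A B (case_sum p q) (case_sum r s) \<gamma>" for \<gamma>
    unfolding assms(9,10) level_edges_def using assms(3,5) by (auto simp: f g subset_iff)
  then have \<C>: "\<C> = (\<Union>\<gamma>. edge_components A B (level_edges R A B (case_sum p q) (case_sum r s) \<gamma>))"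
    using assms(11) by simp
  show ?thesis
    unfolding \<C> left_side_def right_side_def
    by (intro conjI laminar_component_sides assms(8)) simp_all
qed

end
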